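(* Let $G=(V,E)$ be a finite connected simple graph with at least one vertex, let $D\ge 0$ be a real number, and let $K\subseteq V$ be a largest clique of $G$ (a clique of maximum cardinality). Then the flow is maximum if the load is distributed equally between the nodes of $K$: if $\vec m^*$ is the load distribution with $m^*_v=D/|K|$ for $v\in K$ and $m^*_v=0$ for $v\in V\setminus K$, then $\mathcal F(\vec m)\le \mathcal F(\vec m^* )$ for every load distribution $\vec m=(m_v)_{v\in V}$ on $G$ with total load $\sum_{v\in V}m_v=D$.
   Context: A load distribution on a finite graph $G=(V,E)$ is a vector $\vec m=(m_v)_{v\in V}$ of real numbers $m_v\ge 0$; its total load is $\sum_{v\in V}m_v$. The flow of $\vec m$ is $$\mathcal F(\vec m)=\sum_{\{u,v\}\in E} m_u m_v,$$ where each (undirected) edge is counted once. A clique is a set of pairwise adjacent vertices. *)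

theory Defs
  imports Complex_Main "HOL-Library.Ramsey"
begin

text \<open>A graph is a pair of a vertex set \<open>V\<close> and a set \<open>E\<close> of two-element subsets of \<open>V\<close>.
  Cliques are those of \<^theory>\<open>HOL-Library.Ramsey\<close>: the predicate \<^term>\<open>clique K E\<close> does not
  itself require \<open>K \<subseteq> V\<close>.\<close>

definition finite_simple_graph :: "'a set \<Rightarrow> 'a set set \<Rightarrow> bool" where
  "finite_simple_graph V E \<longleftrightarrow> finite V \<and> E \<subseteq> [V]\<^bsup>2\<^esup>"

definition connected_graph :: "'a set \<Rightarrow> 'a set set \<Rightarrow> bool" where
  "connected_graph V E \<longleftrightarrow> (\<forall>u\<in>V. \<forall>v\<in>V. (u, v) \<in> {(x, y). {x, y} \<in> E}\<^sup>*)"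

definition largest_clique :: "'a set \<Rightarrow> 'a set set \<Rightarrow> 'a set \<Rightarrow> bool" where
  "largest_clique V E K \<longleftrightarrow>
     K \<subseteq> V \<and> clique K E \<and> (\<forall>K'. K' \<subseteq> V \<and> clique K' E \<longrightarrow> card K' \<le> card K)"

text \<open>Only the values of \<open>m\<close> on \<open>V\<close> matter.\<close>

definition load_distribution :: "'a set \<Rightarrow> ('a \<Rightarrow> real) \<Rightarrow> bool" where
  "load_distribution V m \<longleftrightarrow> (\<forall>v\<in>V. m v \<ge> 0)"

definition total_load :: "'a set \<Rightarrow> ('a \<Rightarrow> real) \<Rightarrow> real" where
  "total_load V m = (\<Sum>v\<in>V. m v)"

text \<open>An edge \<open>e = {u, v}\<close> has \<open>u \<noteq> v\<close>, so the inner product is \<open>m u * m v\<close>.\<close>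

definition flow :: "'a set set \<Rightarrow> ('a \<Rightarrow> real) \<Rightarrow> real" where
  "flow E m = (\<Sum>e\<in>E. \<Prod>v\<in>e. m v)"

definition equal_load :: "'a set \<Rightarrow> real \<Rightarrow> 'a \<Rightarrow> real" where
  "equal_load K D = (\<lambda>v. if v \<in> K then D / real (card K) else 0)"

end

theory Submission
  imports Defs "HOL-Analysis.Convex"
begin

text \<open>This is the argument of Motzkin and Straus. If two vertices carrying load are not adjacent,
  then the flow is affine in the amount of load moved from one to the other, so moving the whole
  load of one of them to the one with the larger neighbourhood load does not decrease the flow.
  Iterating, the load becomes supported on a clique \<open>S\<close>, where the flow is
  \<open>(D\<^sup>2 - (\<Sum>v\<in>S. (m v)\<^sup>2)) / 2 \<le> (1 - 1 / card S) * D\<^sup>2 / 2\<close> by Cauchy--Schwarz.\<close>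

text \<open>The bilinear form of the adjacency matrix. Summing over ordered pairs instead of edges
  makes it linear in each argument, so that the effect of moving load can be expanded
  algebraically.\<close>

definition adj_form :: "'a set \<Rightarrow> 'a set set \<Rightarrow> ('a \<Rightarrow> real) \<Rightarrow> ('a \<Rightarrow> real) \<Rightarrow> real" where
  "adj_form V E f g = (\<Sum>x\<in>V. \<Sum>y\<in>V. if {x, y} \<in> E then f x * g y else 0)"

lemma adj_form_commute: "adj_form V E f g = adj_form V E g f"
  unfolding adj_form_def
  by (subst sum.swap) (intro sum.cong refl, simp add: insert_commute mult.commute)

lemma adj_form_add_left:
  "adj_form V E (\<lambda>x. f x + g x) h = adj_form V E f h + adj_form V E g h"
  by (simp add: adj_form_def flip: sum.distrib) (intro sum.cong refl, simp add: distrib_right)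

lemma adj_form_add_square:
  "adj_form V E (\<lambda>x. f x + g x) (\<lambda>x. f x + g x) =
    adj_form V E f f + 2 * adj_form V E g f + adj_form V E g g"
proof -
  have "adj_form V E h (\<lambda>x. f x + g x) = adj_form V E h f + adj_form V E h g" for h
    using adj_form_add_left[of V E f g h] by (metis adj_form_commute)
  then show ?thesis
    using adj_form_commute[of V E f g] by (simp add: adj_form_add_left)
qed

lemma adj_form_eq_flow:
  assumes "finite_simple_graph V E"
  shows "adj_form V E m m = 2 * flow E m"
proof -
  have V: "finite V" and EV: "E \<subseteq> [V]\<^bsup>2\<^esup>"
    using assms by (auto simp: finite_simple_graph_def)
  have E: "finite E"
    using EV V by (meson finite_imp_finite_nsets finite_subset)
  let ?P = "{p \<in> V \<times> V. {fst p, snd p} \<in> E}"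
  have "adj_form V E m m =
      (\<Sum>p\<in>V \<times> V. if {fst p, snd p} \<in> E then m (fst p) * m (snd p) else 0)"
    by (simp add: adj_form_def sum.cartesian_product case_prod_unfold)
  also have "\<dots> = (\<Sum>p\<in>?P. m (fst p) * m (snd p))"
    using V by (simp add: sum.inter_filter)
  \<comment> \<open>Ordered pairs are grouped by the edge they span; each edge arises from exactly
    two of them, which gives the factor 2.\<close>
  also have "\<dots> = (\<Sum>e\<in>E. \<Sum>p\<in>{p \<in> ?P. {fst p, snd p} = e}. m (fst p) * m (snd p))"
    using V E by (intro sum.group[symmetric] finite_Collect_conjI) auto
  also have "\<dots> = (\<Sum>e\<in>E. 2 * (\<Prod>v\<in>e. m v))"
  proof (rule sum.cong[OF refl])
    fix e assume e: "e \<in> E"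
    then have "e \<subseteq> V" "card e = 2"
      using EV by (auto simp: nsets_def)
    then obtain u v where uv: "e = {u, v}" "u \<noteq> v" "u \<in> V" "v \<in> V"
      by (auto simp: card_2_iff)
    have "{p \<in> ?P. {fst p, snd p} = e} = {(u, v), (v, u)}"
    proof (rule set_eqI)
      fix p
      have "{fst p, snd p} = e \<longleftrightarrow> p = (u, v) \<or> p = (v, u)"
        by (cases p) (simp add: uv(1) doubleton_eq_iff)
      then show "p \<in> {p \<in> ?P. {fst p, snd p} = e} \<longleftrightarrow> p \<in> {(u, v), (v, u)}"
        using e uv(3,4) by auto
    qed
    then show "(\<Sum>p\<in>{p \<in> ?P. {fst p, snd p} = e}. m (fst p) * m (snd p)) = 2 * (\<Prod>v\<in>e. m v)"
      using uv by (simp add: mult.commute)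
  qed
  finally show ?thesis
    by (simp add: flow_def sum_distrib_left)
qed

text \<open>In the expansion of the squared total, every off-diagonal pair is either an edge of the
  clique or has a factor 0, and diagonal pairs are never edges. Hence only the squares are
  missing.\<close>

lemma adj_form_clique:
  assumes "finite_simple_graph V E" "S \<subseteq> V" "clique S E" "\<And>x. x \<in> V - S \<Longrightarrow> m x = 0"
  shows "adj_form V E m m = (\<Sum>x\<in>V. m x)\<^sup>2 - (\<Sum>x\<in>V. (m x)\<^sup>2)"
proof -
  have V: "finite V" and EV: "E \<subseteq> [V]\<^bsup>2\<^esup>"
    using assms by (auto simp: finite_simple_graph_def)
  have loop: "{x} \<notin> E" for x
    using EV by (auto simp: nsets_def)
  have "adj_form V E m m = (\<Sum>x\<in>V. \<Sum>y\<in>V. m x * m y - (if y = x then m x * m y else 0))"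
    unfolding adj_form_def
  proof (intro sum.cong refl)
    fix x y assume "x \<in> V" "y \<in> V"
    then show "(if {x, y} \<in> E then m x * m y else 0) = m x * m y - (if y = x then m x * m y else 0)"
      using assms(3,4) loop[of x] unfolding clique_def by (cases "x \<in> S"; cases "y \<in> S") auto
  qed
  also have "\<dots> = (\<Sum>x\<in>V. m x)\<^sup>2 - (\<Sum>x\<in>V. (m x)\<^sup>2)"
    using V by (simp add: sum_subtractf sum_product power2_eq_square)
  finally show ?thesis .
qed

text \<open>Write the new load as \<open>m + d\<close>. The term quadratic in \<open>d\<close>
  vanishes because \<open>u\<close> and \<open>v\<close> are not adjacent, and the linear term is
  \<open>m v\<close> times the difference of the two neighbourhood loads, which \<open>le\<close>
  makes nonnegative.\<close>

lemma shift_load_adj_form: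
  assumes G: "finite_simple_graph V E" and "u \<in> V" "v \<in> V" "u \<noteq> v" "{u, v} \<notin> E"
    and "m v \<ge> 0"
    and le: "(\<Sum>y\<in>V. if {v, y} \<in> E then m y else 0) \<le> (\<Sum>y\<in>V. if {u, y} \<in> E then m y else 0)"
  shows "adj_form V E m m \<le> adj_form V E (m(u := m u + m v, v := 0)) (m(u := m u + m v, v := 0))"
proof -
  have V: "finite V" and EV: "E \<subseteq> [V]\<^bsup>2\<^esup>"
    using G by (auto simp: finite_simple_graph_def)
  have loop: "{x} \<notin> E" for x
    using EV by (auto simp: nsets_def)
  \<comment> \<open>Two one-point functions, so that sums over \<open>V\<close> collapse to the
    values at \<open>u\<close> and \<open>v\<close>.\<close>
  define d where "d x = (if x = u then m v else 0) + (if x = v then - m v else 0)" for x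
  have d: "adj_form V E d g = m v * (\<Sum>y\<in>V. if {u, y} \<in> E then g y else 0)
      - m v * (\<Sum>y\<in>V. if {v, y} \<in> E then g y else 0)" for g
  proof -
    have "adj_form V E d g = (\<Sum>x\<in>V. d x * (\<Sum>y\<in>V. if {x, y} \<in> E then g y else 0))"
      unfolding adj_form_def sum_distrib_left by (intro sum.cong refl) simp
    also have "\<dots> = (\<Sum>x\<in>V. (if x = u then m v * (\<Sum>y\<in>V. if {x, y} \<in> E then g y else 0) else 0)
        + (if x = v then - m v * (\<Sum>y\<in>V. if {x, y} \<in> E then g y else 0) else 0))"
      by (intro sum.cong refl) (simp add: d_def)
    finally show ?thesis
      using V assms by (simp add: sum.distrib)
  qed
  \<comment> \<open>\<open>d\<close> is supported on \<open>u\<close> and \<open>v\<close>, and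
    neither is a neighbour of itself or of the other.\<close>
  have "(\<Sum>y\<in>V. if {u, y} \<in> E then d y else 0) = 0" "(\<Sum>y\<in>V. if {v, y} \<in> E then d y else 0) = 0"
    using assms loop by (auto intro!: sum.neutral simp: d_def insert_commute)
  then have "adj_form V E d d = 0"
    by (simp add: d)
  moreover have "adj_form V E d m \<ge> 0"
    using mult_left_mono[OF le \<open>m v \<ge> 0\<close>] by (simp add: d)
  moreover have "m(u := m u + m v, v := 0) = (\<lambda>x. m x + d x)"
    using \<open>u \<noteq> v\<close> by (auto simp: d_def)
  ultimately show ?thesis
    by (simp add: adj_form_add_square)
qed

text \<open>Induction on the number of loaded vertices: as long as the support is not a clique, a
  shift between two nonadjacent loaded vertices empties one of them.\<close>

lemma adj_form_concentrate_on_clique: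
  assumes G: "finite_simple_graph V E" and "load_distribution V m"
  obtains m' S where "load_distribution V m'" "total_load V m' = total_load V m"
    "adj_form V E m m \<le> adj_form V E m' m'" "S \<subseteq> V" "clique S E" "\<And>x. x \<in> V - S \<Longrightarrow> m' x = 0"
proof -
  have V: "finite V"
    using G by (auto simp: finite_simple_graph_def)
  have "\<exists>m' S. load_distribution V m' \<and> total_load V m' = total_load V m \<and>
    adj_form V E m m \<le> adj_form V E m' m' \<and> S \<subseteq> V \<and> clique S E \<and> (\<forall>x\<in>V - S. m' x = 0)"
    using assms(2)
  proof (induction "card {x \<in> V. m x \<noteq> 0}" arbitrary: m rule: less_induct)
    case less
    let ?S = "{x \<in> V. m x \<noteq> 0}"
    let ?w = "\<lambda>x. \<Sum>y\<in>V. if {x, y} \<in> E then m y else 0"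
    show ?case
    proof (cases "clique ?S E")
      case True
      then show ?thesis
        using less.prems by (intro exI[of _ m] exI[of _ ?S]) auto
    next
      case False
      then obtain a b where ab: "a \<in> ?S" "b \<in> ?S" "a \<noteq> b" "{a, b} \<notin> E"
        by (auto simp: clique_def)
      \<comment> \<open>By symmetry, \<open>u\<close> names the endpoint with the larger
        neighbourhood load, which receives the load of \<open>v\<close>.\<close>
      obtain u v where uv: "u \<in> ?S" "v \<in> ?S" "u \<noteq> v" "{u, v} \<notin> E" "?w v \<le> ?w u"
        using ab by (cases "?w b \<le> ?w a") (auto simp: insert_commute)
      let ?m = "m(u := m u + m v, v := 0)"
      have nonneg: "m x \<ge> 0" if "x \<in> V" for x
        using less.prems that by (simp add: load_distribution_def)
      \<comment> \<open>\<open>v\<close> leaves the support, and the receiving vertex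
        \<open>u\<close> was already in it.\<close>
      have "{x \<in> V. ?m x \<noteq> 0} \<subset> ?S"
        using uv by auto
      then have "card {x \<in> V. ?m x \<noteq> 0} < card ?S"
        using V by (intro psubset_card_mono) auto
      moreover have load: "load_distribution V ?m"
        using nonneg uv by (simp add: load_distribution_def)
      ultimately obtain m' S where *: "load_distribution V m'" "total_load V m' = total_load V ?m"
        "adj_form V E ?m ?m \<le> adj_form V E m' m'" "S \<subseteq> V" "clique S E" "\<forall>x\<in>V - S. m' x = 0"
        using less.hyps[of ?m] by blast
      have "total_load V ?m =
          (\<Sum>x\<in>V. m x + ((if x = u then m v else 0) + (if x = v then - m v else 0)))"
        unfolding total_load_def using uv by (intro sum.cong refl) auto
      also have "\<dots> = total_load V m"
        using V uv by (simp add: sum.distrib total_load_def)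
      finally have "total_load V ?m = total_load V m" .
      moreover have "adj_form V E m m \<le> adj_form V E ?m ?m"
        using uv nonneg by (intro shift_load_adj_form[OF G]) auto
      ultimately show ?thesis
        using * by (intro exI[of _ m'] exI[of _ S]) auto
    qed
  qed
  then show ?thesis
    using that by metis
qed

theorem theorem4:
  fixes V K :: "'a set" and E :: "'a set set" and D :: real
  assumes "finite_simple_graph V E"
    and "connected_graph V E"
    and "V \<noteq> {}"
    and "D \<ge> 0"
    and "largest_clique V E K"
  shows "load_distribution V (equal_load K D) \<and> total_load V (equal_load K D) = D \<and>
    (\<forall>m. load_distribution V m \<and> total_load V m = D \<longrightarrow> flow E m \<le> flow E (equal_load K D))"
proof -
  let ?e = "equal_load K D"
  have V: "finite V"
    using assms(1) by (auto simp: finite_simple_graph_def)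
  have K: "K \<subseteq> V" "clique K E" and max: "\<And>S. S \<subseteq> V \<Longrightarrow> clique S E \<Longrightarrow> card S \<le> card K"
    using assms(5) by (auto simp: largest_clique_def)
  obtain v where "v \<in> V"
    using assms(3) by blast
  \<comment> \<open>A single vertex is a clique, so division by \<open>card K\<close> is meaningful
    below.\<close>
  then have pos: "card K > 0"
    using max[of "{v}"] by (simp add: clique_def)
  have load: "load_distribution V ?e"
    using assms(4) by (simp add: load_distribution_def equal_load_def)
  have sum_K: "(\<Sum>x\<in>V. if x \<in> K then c else 0) = card K * c" for c :: real
    using V K(1) by (simp add: sum.If_cases Int_absorb1)
  have total: "total_load V ?e = D"
    using pos by (simp add: total_load_def equal_load_def sum_K)
  have "(\<Sum>x\<in>V. (?e x)\<^sup>2) = (\<Sum>x\<in>V. if x \<in> K then (D / card K)\<^sup>2 else 0)"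
    by (intro sum.cong refl) (simp add: equal_load_def)
  also have "\<dots> = D\<^sup>2 / card K"
    using pos by (simp add: sum_K power2_eq_square)
  finally have "adj_form V E ?e ?e = D\<^sup>2 - D\<^sup>2 / card K"
    using adj_form_clique[OF assms(1) K, of ?e] total
    by (simp add: equal_load_def total_load_def)
  moreover have "adj_form V E m m \<le> D\<^sup>2 - D\<^sup>2 / card K"
    if m: "load_distribution V m" "total_load V m = D" for m
  proof -
    obtain m' S where *: "total_load V m' = total_load V m"
      "adj_form V E m m \<le> adj_form V E m' m'" "S \<subseteq> V" "clique S E" "\<And>x. x \<in> V - S \<Longrightarrow> m' x = 0"
      using adj_form_concentrate_on_clique[OF assms(1) m(1)] by metis
    have "D = (\<Sum>x\<in>S. m' x)"
      using * m(2) V by (simp add: total_load_def sum.mono_neutral_right)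
    \<comment> \<open>Cauchy-Schwarz against the constant 1 on \<open>S\<close>. The product form
      avoids dividing by \<open>card S\<close>, which is 0 if \<open>S\<close> is empty; that can
      occur when \<open>D = 0\<close>.\<close>
    then have "D\<^sup>2 \<le> card S * (\<Sum>x\<in>S. (m' x)\<^sup>2)"
      using sum_squared_le_sum_of_squares[of m' S] by (simp add: mult.commute)
    also have "(\<Sum>x\<in>S. (m' x)\<^sup>2) = (\<Sum>x\<in>V. (m' x)\<^sup>2)"
      using * V by (intro sum.mono_neutral_left) auto
    \<comment> \<open>This is where the maximality of \<open>K\<close> enters: \<open>S\<close> is a
      clique in \<open>V\<close>.\<close>
    also have "card S * (\<Sum>x\<in>V. (m' x)\<^sup>2) \<le> card K * (\<Sum>x\<in>V. (m' x)\<^sup>2)"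
      using max[of S] * by (intro mult_right_mono) (auto intro: sum_nonneg)
    finally have "D\<^sup>2 / card K \<le> (\<Sum>x\<in>V. (m' x)\<^sup>2)"
      using pos by (simp add: field_simps)
    moreover have "adj_form V E m' m' = D\<^sup>2 - (\<Sum>x\<in>V. (m' x)\<^sup>2)"
      using adj_form_clique[OF assms(1) *(3,4), of m'] *(1,5) m(2) by (simp add: total_load_def)
    ultimately show ?thesis
      using *(2) by linarith
  qed
  ultimately show ?thesis
    using load total by (fastforce simp: adj_form_eq_flow[OF assms(1)])
qed

end
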